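(* Let $n \geq 1$ be an integer. The association $(\mathcal{G},c) \mapsto \Phi^{\mathcal{G},c}$ restricts to a bijection between crystallographs on the set of nodes $\{1,\dots,n\}$ and root subsystems of $BC_n$.
   Context: Let $V=\mathbb{C}^n$ with canonical basis $(e_1,\dots,e_n)$ and scalar product $(e_i\mid e_j)=\delta_{ij}$; put $e^{\pm}_{ij}=e_i\pm e_j$. Then $BC_n=\{\pm e^-_{ij},\pm e^+_{ij} : i\neq j\}\cup\{\pm e_i,\pm 2e_i : 1\le i\le n\}\subseteq V\setminus\{0\}$. A root subsystem of $BC_n$ is a subset $\Phi\subseteq BC_n$ such that $\sigma_\alpha(\Phi)\subseteq\Phi$ for all $\alpha\in\Phi$, where $\sigma_\alpha$ is the orthogonal reflection in the hyperplane orthogonal to $\alpha$ (the empty set is allowed). A bichromatic graph $(\mathcal{G},c)$ on nodes $\{1,\dots,n\}$ is a graph with unoriented edges, which are either straight edges $\{i,j\}$ ($i\ne j$) or loop edges $\{k\}$, each coloured red or green by $c$, such that two distinct edges with the same underlying node set have different colours. So between two distinct nodes there is at most one red and at most one green straight edge, and at each node at most one red and at most one green loop edge. Correspondence: $\Phi^{\mathcal{G},c}\subseteq BC_n$ is the set consisting exactly of: $\pm e^-_{ij}$ for each red straight edge $\{i,j\}$; $\pm e^+_{ij}$ for each green straight edge $\{i,j\}$; $\pm e_k$ for each red loop edge at $k$; $\pm 2e_k$ for each green loop edge at $k$. This is a bijection between bichromatic graphs on $\{1,\dots,n\}$ and subsets of $BC_n$ stable under $\alpha\mapsto-\alpha$.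 A bichromatic graph is a crystallograph if: (1) for any three distinct nodes $i,j,k$, if there are straight edges $\{i,j\}$ and $\{j,k\}$ then there is a straight edge $\{i,k\}$ which is red if the first two have the same colour, and green if they have different colours; (2) if a node $i$ is incident to a loop edge and to a straight edge $\{i,j\}$, then the graph contains both the red and the green straight edge $\{i,j\}$, and a loop edge at $j$ of the same colour as the one at $i$. *)

theory Defs
  imports "HOL-Analysis.Analysis"
begin

text \<open>The finite index type \<open>'n\<close> plays the role of the node set \<open>{1, \<dots>, n}\<close>; it is nonempty, so
  \<open>n = CARD('n) \<ge> 1\<close>.\<close>

text \<open>The standard Hermitian scalar product. The library's inner product on this type is
  real-valued (it is the real part of this one).\<close>

definition scalar_prod :: "complex ^ 'n \<Rightarrow> complex ^ 'n \<Rightarrow> complex" where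
  "scalar_prod x y = (\<Sum>i\<in>UNIV. x $ i * cnj (y $ i))"

definition reflection :: "complex ^ 'n \<Rightarrow> complex ^ 'n \<Rightarrow> complex ^ 'n" where
  "reflection \<alpha> v = v - (2 * scalar_prod v \<alpha> / scalar_prod \<alpha> \<alpha>) *s \<alpha>"

definition basis_vec :: "'n \<Rightarrow> complex ^ 'n" where
  "basis_vec i = axis i 1"

definition e_minus :: "'n \<Rightarrow> 'n \<Rightarrow> complex ^ 'n" where
  "e_minus i j = basis_vec i - basis_vec j"

definition e_plus :: "'n \<Rightarrow> 'n \<Rightarrow> complex ^ 'n" where
  "e_plus i j = basis_vec i + basis_vec j"

definition BC :: "(complex ^ 'n) set" where
  "BC = {v. \<exists>i j. i \<noteq> j \<and> v \<in> {e_minus i j, - e_minus i j, e_plus i j, - e_plus i j}}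
      \<union> {v. \<exists>i. v \<in> {basis_vec i, - basis_vec i, 2 *s basis_vec i, - (2 *s basis_vec i)}}"

definition root_subsystem :: "(complex ^ 'n) set \<Rightarrow> bool" where
  "root_subsystem \<Phi> \<longleftrightarrow> \<Phi> \<subseteq> BC \<and> (\<forall>\<alpha>\<in>\<Phi>. reflection \<alpha> ` \<Phi> \<subseteq> \<Phi>)"

datatype colour = Red | Green

text \<open>Two distinct edges with the same underlying node set have different colours, so an edge is
  determined by its node set together with its colour, and a bichromatic graph is a set of
  such pairs. Straight edges have a two-element node set, loops a singleton.\<close>

type_synonym 'n coloured_graph = "('n set \<times> colour) set"

definition bichromatic_graph :: "'n coloured_graph \<Rightarrow> bool" where
  "bichromatic_graph G \<longleftrightarrow>
     (\<forall>(e, c) \<in> G. (\<exists>i j. i \<noteq> j \<and> e = {i, j}) \<or> (\<exists>k. e = {k}))"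

definition crystallograph :: "'n coloured_graph \<Rightarrow> bool" where
  "crystallograph G \<longleftrightarrow> bichromatic_graph G \<and>
     (\<forall>i j k c d. i \<noteq> j \<and> j \<noteq> k \<and> i \<noteq> k \<and> ({i, j}, c) \<in> G \<and> ({j, k}, d) \<in> G \<longrightarrow>
        ({i, k}, if c = d then Red else Green) \<in> G) \<and>
     (\<forall>i j c d. i \<noteq> j \<and> ({i}, c) \<in> G \<and> ({i, j}, d) \<in> G \<longrightarrow>
        ({i, j}, Red) \<in> G \<and> ({i, j}, Green) \<in> G \<and> ({j}, c) \<in> G)"

definition graph_roots :: "'n coloured_graph \<Rightarrow> (complex ^ 'n) set" where
  "graph_roots G =
     {v. \<exists>i j. i \<noteq> j \<and> ({i, j}, Red) \<in> G \<and> v \<in> {e_minus i j, - e_minus i j}}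
   \<union> {v. \<exists>i j. i \<noteq> j \<and> ({i, j}, Green) \<in> G \<and> v \<in> {e_plus i j, - e_plus i j}}
   \<union> {v. \<exists>k. ({k}, Red) \<in> G \<and> v \<in> {basis_vec k, - basis_vec k}}
   \<union> {v. \<exists>k. ({k}, Green) \<in> G \<and> v \<in> {2 *s basis_vec k, - (2 *s basis_vec k)}}"

end

theory Submission
  imports Defs
begin

text \<open>Every root of \<open>BC\<^sub>n\<close> is, up to sign, attached to one coloured edge, and both the node set
  and the colour of this edge can be read off from the coordinates of the root: the node set is the
  support, and the edge is green precisely when the coordinate sum squares to 4. Let
  \<open>root_edge v\<close> be this edge. Then \<open>graph_roots G\<close> consists of the roots \<open>v\<close> with
  \<open>root_edge v \<in> G\<close>. As \<open>root_edge\<close> maps the roots onto the coloured edges, with fibres the pairs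
  \<open>{v, -v}\<close>, taking preimages is a bijection from bichromatic graphs to sets of roots that are
  stable under negation (lemma \<open>bij_betw_graph_roots_symmetric\<close>).

  A root subsystem is stable under negation, because a reflection negates its own root. It remains
  to see that the roots of a bichromatic graph are closed under reflections if and only if the
  graph is a crystallograph (lemma \<open>root_subsystem_graph_roots_iff\<close>). Reflections only have to be
  computed up to sign, and give the following. Let red count as \<open>-1\<close> and green as \<open>1\<close>, so that an
  edge of colour \<open>c\<close> between \<open>i\<close> and \<open>j\<close> stands for the root \<open>e\<^sub>i + c e\<^sub>j\<close>. Reflecting in it sends
  \<open>e\<^sub>i + d e\<^sub>k\<close> to a multiple by a sign of \<open>e\<^sub>j - c d e\<^sub>k\<close>, which is the triangle condition, and moves
  a loop at \<open>i\<close> to a loop of the same colour at \<open>j\<close>. Reflecting in a loop at \<open>i\<close> changes the colour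
  of every straight edge at \<open>i\<close>. All other reflections fix the edge, and hence impose nothing.\<close>

section \<open>Roots attached to coloured edges\<close>

primrec colour_sign :: "colour \<Rightarrow> complex" where
  "colour_sign Red = - 1"
| "colour_sign Green = 1"

definition straight_root :: "'n \<Rightarrow> 'n \<Rightarrow> colour \<Rightarrow> complex ^ 'n" where
  "straight_root i j c = basis_vec i + colour_sign c *s basis_vec j"

definition loop_root :: "'n \<Rightarrow> colour \<Rightarrow> complex ^ 'n" where
  "loop_root k c = (case c of Red \<Rightarrow> 1 | Green \<Rightarrow> 2) *s basis_vec k"

text \<open>The coordinate sum of a root is \<open>0\<close> for a red straight edge, \<open>\<plusminus>1\<close> for a red loop and \<open>\<plusminus>2\<close>
  for both kinds of green edges; squaring removes the sign.\<close>

definition root_edge :: "complex ^ 'n \<Rightarrow> 'n::finite set \<times> colour" where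
  "root_edge v = ({p. v $ p \<noteq> 0}, if (\<Sum>p\<in>UNIV. v $ p)\<^sup>2 = 4 then Green else Red)"

lemma basis_vec_component: "basis_vec i $ p = (if p = i then 1 else 0)"
  by (simp add: basis_vec_def axis_def)

lemma colour_sign_simps [simp]:
  "colour_sign c * colour_sign c = 1" "cnj (colour_sign c) = colour_sign c" "colour_sign c \<noteq> 0"
  by (cases c; simp)+

lemma straight_root_component:
  "straight_root i j c $ p = (if p = i then 1 else 0) + (if p = j then colour_sign c else 0)"
  by (simp add: straight_root_def basis_vec_component)

lemma loop_root_component:
  "loop_root k c $ p = (if p = k then (case c of Red \<Rightarrow> 1 | Green \<Rightarrow> 2) else 0)"
  by (simp add: loop_root_def basis_vec_component)

text \<open>These equations unfold the given description of roots into roots of coloured edges. The last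
  left-hand side contains \<open>loop_root\<close> because the third equation has rewritten the basis vector
  before the last one applies.\<close>

lemma standard_roots:
  "e_plus i j = straight_root i j Green" "e_minus i j = straight_root i j Red"
  "basis_vec k = loop_root k Red" "2 *s loop_root k Red = loop_root k Green"
  by (simp_all add: straight_root_def loop_root_def e_plus_def e_minus_def)

lemma straight_root_swap: "straight_root j i c = colour_sign c *s straight_root i j c"
  by (simp add: vec_eq_iff straight_root_component algebra_simps)

lemma root_edge_uminus [simp]: "root_edge (- v) = root_edge v"
  by (simp add: root_edge_def sum_negf)

lemma root_edge_straight_root [simp]:
  assumes "i \<noteq> j"
  shows "root_edge (straight_root i j c) = ({i, j}, c)"
  using assms by (cases c) (auto simp: root_edge_def straight_root_component sum.distrib)

lemma root_edge_loop_root [simp]: "root_edge (loop_root k c) = ({k}, c)"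
  by (cases c) (auto simp: root_edge_def loop_root_component)

lemma straight_root_in_BC [simp]: "i \<noteq> j \<Longrightarrow> straight_root i j c \<in> BC"
  by (cases c) (fastforce simp: BC_def straight_root_def e_plus_def e_minus_def)+

lemma loop_root_in_BC [simp]: "loop_root k c \<in> BC"
  by (cases c) (auto simp: BC_def loop_root_def)

lemma uminus_in_BC_iff [simp]: "- v \<in> BC \<longleftrightarrow> v \<in> BC"
proof -
  have "- w \<in> BC" if "w \<in> BC" for w :: "complex ^ 'n"
    using that unfolding BC_def by fastforce
  from this[of v] this[of "- v"] show ?thesis by auto
qed

lemma BC_cases:
  assumes "v \<in> BC"
  obtains (straight) i j c where "i \<noteq> j" "v = straight_root i j c \<or> v = - straight_root i j c"
  | (loop) k c where "v = loop_root k c \<or> v = - loop_root k c"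
  using assms straight loop unfolding BC_def standard_roots by fast

lemma root_edge_eq_straightD:
  assumes "v \<in> BC" "i \<noteq> j" "root_edge v = ({i, j}, c)"
  shows "v = straight_root i j c \<or> v = - straight_root i j c"
  using assms(1)
proof (cases rule: BC_cases)
  case (straight k l d)
  with assms have "{k, l} = {i, j}" "d = c" by auto
  then consider "k = i" "l = j" | "k = j" "l = i" by (auto simp: doubleton_eq_iff)
  then show ?thesis
  proof cases
    case 2
    then show ?thesis
      using straight \<open>d = c\<close> straight_root_swap[of j i c] by (cases c) auto
  qed (use straight \<open>d = c\<close> in auto)
next
  case (loop k d)
  with assms show ?thesis by auto
qed

lemma root_edge_eq_loopD:
  assumes "v \<in> BC" "root_edge v = ({k}, c)"
  shows "v = loop_root k c \<or> v = - loop_root k c"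
  using assms(1)
proof (cases rule: BC_cases)
  case (straight i j d)
  with assms show ?thesis by auto
qed (use assms in auto)

text \<open>The only freedom that an edge leaves is the sign: its node set and colour determine the
  coefficients up to a common factor \<open>\<plusminus>1\<close>, and interchanging the ends of a red edge is such a
  factor.\<close>

lemma root_edge_fibre:
  assumes "v \<in> BC" "w \<in> BC" "root_edge v = root_edge w"
  shows "v = w \<or> v = - w"
  using assms(2)
proof (cases rule: BC_cases)
  case (straight i j c)
  then show ?thesis using root_edge_eq_straightD[OF assms(1), of i j c] assms(3) by auto
next
  case (loop k c)
  then show ?thesis using root_edge_eq_loopD[OF assms(1), of k c] assms(3) by auto
qed

section \<open>Bichromatic graphs and symmetric sets of roots\<close>

text \<open>Passing from a graph to its roots is taking a preimage under \<open>root_edge\<close>; membership of any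
  explicit root thus reduces to computing its edge.\<close>

lemma graph_roots_eq: "graph_roots G = {v \<in> BC. root_edge v \<in> G}"
proof -
  have "v \<in> BC \<and> root_edge v \<in> G" if "v \<in> graph_roots G" for v
    using that unfolding graph_roots_def standard_roots by auto
  moreover have "v \<in> graph_roots G" if "v \<in> BC" "root_edge v \<in> G" for v
    using that(1)
  proof (cases rule: BC_cases)
    case (straight i j c)
    then have "({i, j}, c) \<in> G" using that(2) by auto
    with straight show ?thesis unfolding graph_roots_def standard_roots by (cases c) blast+
  next
    case (loop k c)
    then show ?thesis using that(2) unfolding graph_roots_def standard_roots by (cases c) auto
  qed
  ultimately show ?thesis by auto
qed

lemma straight_root_in_graph_roots [simp]:
  "i \<noteq> j \<Longrightarrow> straight_root i j c \<in> graph_roots G \<longleftrightarrow> ({i, j}, c) \<in> G"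
  by (simp add: graph_roots_eq)

lemma loop_root_in_graph_roots [simp]: "loop_root k c \<in> graph_roots G \<longleftrightarrow> ({k}, c) \<in> G"
  by (simp add: graph_roots_eq)

lemma uminus_in_graph_roots [simp]: "- v \<in> graph_roots G \<longleftrightarrow> v \<in> graph_roots G"
  by (simp add: graph_roots_eq)

lemma colour_sign_scale_in_graph_roots [simp]:
  "colour_sign c *s v \<in> graph_roots G \<longleftrightarrow> v \<in> graph_roots G"
  by (cases c) auto

lemma graph_roots_cases:
  assumes "v \<in> graph_roots G"
  obtains (straight) i j c where "i \<noteq> j" "({i, j}, c) \<in> G"
      "v = straight_root i j c \<or> v = - straight_root i j c"
  | (loop) k c where "({k}, c) \<in> G" "v = loop_root k c \<or> v = - loop_root k c"
proof -
  from assms have "v \<in> BC" "root_edge v \<in> G" by (auto simp: graph_roots_eq)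
  from this(1) show ?thesis
    by (cases rule: BC_cases) (use \<open>root_edge v \<in> G\<close> straight loop in auto)
qed

lemma bichromatic_graph_iff_subset_edges: "bichromatic_graph G \<longleftrightarrow> G \<subseteq> root_edge ` BC"
proof
  assume G: "bichromatic_graph G"
  show "G \<subseteq> root_edge ` BC"
  proof
    fix x assume "x \<in> G"
    obtain e c where x: "x = (e, c)" by (cases x)
    with G \<open>x \<in> G\<close> consider i j where "i \<noteq> j" "e = {i, j}" | k where "e = {k}"
      unfolding bichromatic_graph_def by blast
    then show "x \<in> root_edge ` BC"
    proof cases
      case 1
      then show ?thesis by (intro image_eqI[of _ _ "straight_root i j c"]) (auto simp: x)
    next
      case 2
      then show ?thesis by (intro image_eqI[of _ _ "loop_root k c"]) (auto simp: x)
    qed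
  qed
next
  assume G: "G \<subseteq> root_edge ` BC"
  show "bichromatic_graph G"
    unfolding bichromatic_graph_def
  proof safe
    fix e c assume "(e, c) \<in> G" and nl: "\<nexists>k. e = {k}"
    with G obtain v where v: "v \<in> BC" "root_edge v = (e, c)" by force
    from v(1) show "\<exists>i j. i \<noteq> j \<and> e = {i, j}"
      by (cases rule: BC_cases) (use v(2) nl in \<open>auto, blast+\<close>)
  qed
qed

text \<open>The inverse is the image under \<open>root_edge\<close>: the image of a preimage gives back the graph since
  \<open>root_edge\<close> is onto the possible edges, and the preimage of an image only adds negatives.\<close>

lemma bij_betw_graph_roots_symmetric:
  "bij_betw graph_roots {G :: 'n::finite coloured_graph. bichromatic_graph G}
    {\<Phi>. \<Phi> \<subseteq> BC \<and> uminus ` \<Phi> \<subseteq> \<Phi>}"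
proof (rule bij_betw_byWitness[where f' = "image root_edge"])
  show "\<forall>G\<in>{G. bichromatic_graph G}. root_edge ` graph_roots G = G"
    by (auto simp: bichromatic_graph_iff_subset_edges graph_roots_eq)
  have "graph_roots (root_edge ` \<Phi>) = \<Phi>"
    if \<Phi>: "\<Phi> \<subseteq> BC" "uminus ` \<Phi> \<subseteq> \<Phi>" for \<Phi> :: "(complex ^ 'n) set"
  proof (intro equalityI subsetI)
    fix v assume "v \<in> graph_roots (root_edge ` \<Phi>)"
    then obtain w where "v \<in> BC" "w \<in> \<Phi>" "root_edge v = root_edge w"
      by (auto simp: graph_roots_eq)
    with root_edge_fibre[of v w] \<Phi> show "v \<in> \<Phi>" by auto
  qed (use \<Phi> in \<open>auto simp: graph_roots_eq\<close>)
  then show "\<forall>\<Phi>\<in>{\<Phi> :: (complex ^ 'n) set. \<Phi> \<subseteq> BC \<and> uminus ` \<Phi> \<subseteq> \<Phi>}.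
      graph_roots (root_edge ` \<Phi>) = \<Phi>"
    by blast
  show "graph_roots ` {G. bichromatic_graph G} \<subseteq> {\<Phi>. \<Phi> \<subseteq> BC \<and> uminus ` \<Phi> \<subseteq> \<Phi>}"
    by (auto simp: graph_roots_eq)
  show "image root_edge ` {\<Phi>. \<Phi> \<subseteq> BC \<and> uminus ` \<Phi> \<subseteq> \<Phi>} \<subseteq> {G. bichromatic_graph G}"
    by (auto simp: bichromatic_graph_iff_subset_edges)
qed

section \<open>Reflections of roots\<close>

lemma scalar_prod_uminus:
  "scalar_prod (- x) y = - scalar_prod x y" "scalar_prod x (- y) = - scalar_prod x y"
  by (simp_all add: scalar_prod_def sum_negf)

lemma reflection_uminus [simp]:
  "reflection (- \<alpha>) v = reflection \<alpha> v" "reflection \<alpha> (- v) = - reflection \<alpha> v"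
  by (simp_all add: vec_eq_iff reflection_def scalar_prod_uminus)

lemma scalar_prod_basis_vec: "scalar_prod v (basis_vec k) = v $ k"
  by (simp add: scalar_prod_def basis_vec_component if_distrib cong: if_cong)

lemma scalar_prod_add_right: "scalar_prod v (x + y) = scalar_prod v x + scalar_prod v y"
  by (simp add: scalar_prod_def distrib_left sum.distrib)

lemma scalar_prod_scale_right: "scalar_prod v (a *s x) = cnj a * scalar_prod v x"
  by (simp add: scalar_prod_def sum_distrib_left mult.left_commute)

lemma reflection_straight_root:
  assumes "i \<noteq> j"
  shows "reflection (straight_root i j c) v =
    v - (v $ i + colour_sign c * v $ j) *s straight_root i j c"
proof -
  have prod: "scalar_prod w (straight_root i j c) = w $ i + colour_sign c * w $ j" for w
    by (simp add: straight_root_def scalar_prod_add_right scalar_prod_scale_right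
        scalar_prod_basis_vec)
  have "scalar_prod (straight_root i j c) (straight_root i j c) = 2"
    using assms by (simp add: prod straight_root_component)
  then show ?thesis by (simp add: reflection_def prod del: distrib_left_numeral)
qed

text \<open>Reflections do not see the length of the root, so loops of both colours act alike, by
  negating one coordinate.\<close>

lemma reflection_loop_root: "reflection (loop_root k c) v = v - (2 * v $ k) *s basis_vec k"
  by (cases c)
     (simp_all add: reflection_def loop_root_def scalar_prod_scale_right scalar_prod_basis_vec
       basis_vec_component vector_smult_assoc)

text \<open>Two straight edges sharing the node \<open>i\<close> produce the third side of the triangle. The coefficient
  of \<open>e\<^sub>j\<close> relative to \<open>e\<^sub>k\<close> is minus the product of the two colour signs, so equal colours give a
  red edge.\<close>

lemma reflection_straight_root_adjacent:
  assumes "i \<noteq> j" "j \<noteq> k" "i \<noteq> k"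
  shows "reflection (straight_root i j c) (straight_root i k d) =
    - (colour_sign c *s straight_root j k (if c = d then Red else Green))"
  using assms
  by (cases c; cases d)
     (auto simp: reflection_straight_root vec_eq_iff straight_root_component)

lemma reflection_straight_root_parallel:
  assumes "i \<noteq> j"
  shows "reflection (straight_root i j c) (straight_root i j d) =
    (if c = d then - straight_root i j d else straight_root i j d)"
  using assms
  by (cases c; cases d)
     (auto simp: reflection_straight_root vec_eq_iff straight_root_component)

lemma reflection_straight_root_disjoint:
  assumes "i \<noteq> j" "k \<notin> {i, j}" "l \<notin> {i, j}"
  shows "reflection (straight_root i j c) (straight_root k l d) = straight_root k l d"
  using assms by (auto simp: reflection_straight_root straight_root_component vec_eq_iff)

lemma reflection_straight_root_loop:
  assumes "i \<noteq> j"
  shows "reflection (straight_root i j c) (loop_root i d) = - (colour_sign c *s loop_root j d)"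
  using assms
  by (auto simp: reflection_straight_root vec_eq_iff straight_root_component loop_root_component)

lemma reflection_straight_root_loop_disjoint:
  assumes "i \<noteq> j" "k \<notin> {i, j}"
  shows "reflection (straight_root i j c) (loop_root k d) = loop_root k d"
  using assms by (auto simp: reflection_straight_root vec_eq_iff loop_root_component)

text \<open>Negating the coordinate at \<open>i\<close> exchanges, up to sign, \<open>e\<^sub>i - e\<^sub>j\<close> and \<open>e\<^sub>i + e\<^sub>j\<close>: this is why
  a loop forces straight edges at its node to occur in both colours.\<close>

lemma reflection_loop_root_straight:
  assumes "i \<noteq> j"
  shows "reflection (loop_root i c) (straight_root i j d) =
    - straight_root i j (case d of Red \<Rightarrow> Green | Green \<Rightarrow> Red)"
  using assms
  by (cases d)
     (auto simp: reflection_loop_root vec_eq_iff straight_root_component basis_vec_component)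

lemma reflection_loop_root_straight_disjoint:
  assumes "k \<notin> {i, j}"
  shows "reflection (loop_root k c) (straight_root i j d) = straight_root i j d"
  using assms by (auto simp: reflection_loop_root straight_root_component vec_eq_iff)

lemma reflection_loop_root_loop:
  "reflection (loop_root k c) (loop_root l d) = (if k = l then - loop_root l d else loop_root l d)"
  by (auto simp: reflection_loop_root vec_eq_iff loop_root_component basis_vec_component)

lemma reflection_self:
  assumes "v \<in> BC"
  shows "reflection v v = - v"
  using assms
proof (cases rule: BC_cases)
  case (straight i j c)
  have "reflection (straight_root i j c) (straight_root i j c) = - straight_root i j c"
    using straight(1) by (simp add: reflection_straight_root_parallel)
  then show ?thesis using straight(2) by auto
next
  case (loop k c)
  then show ?thesis by (auto simp: reflection_loop_root_loop)
qed

section \<open>Crystallographs and closure under reflections\<close>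

text \<open>The triangle condition
  covers two straight edges with exactly one common node, the loop condition a loop at an end of a
  straight edge; in the remaining cases the root is fixed or negated.\<close>

lemma crystallograph_closed:
  assumes "crystallograph G" "\<alpha> \<in> graph_roots G" "\<beta> \<in> graph_roots G"
  shows "reflection \<alpha> \<beta> \<in> graph_roots G"
proof -
  have triangle: "({i, k}, if c = d then Red else Green) \<in> G"
    if "i \<noteq> j" "j \<noteq> k" "i \<noteq> k" "({i, j}, c) \<in> G" "({j, k}, d) \<in> G" for i j k c d
    using assms(1) that unfolding crystallograph_def by blast
  have loop: "({i, j}, c') \<in> G \<and> ({j}, c) \<in> G"
    if "i \<noteq> j" "({i}, c) \<in> G" "({i, j}, d) \<in> G" for i j c c' d
    using assms(1) that unfolding crystallograph_def by (cases c') blast+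
  have straight_straight: "reflection (straight_root i j c) (straight_root k l d) \<in> graph_roots G"
    if ij: "i \<noteq> j" "({i, j}, c) \<in> G" and kl: "k \<noteq> l" "({k, l}, d) \<in> G" for i j k l c d
  proof -
    \<comment> \<open>Swapping the ends of an edge only changes the sign of its root, so a common node may be
      taken to be the first end of both edges.\<close>
    have common: "reflection (straight_root a b c) (straight_root a m d) \<in> graph_roots G"
      if "a \<noteq> b" "({a, b}, c) \<in> G" "a \<noteq> m" "({a, m}, d) \<in> G" for a b m
    proof (cases "b = m")
      case True
      then show ?thesis using that by (simp add: reflection_straight_root_parallel)
    next
      case False
      with that triangle[of b a m c d] show ?thesis
        by (auto simp: reflection_straight_root_adjacent insert_commute)
    qed
    have swap: "reflection (straight_root j i c) w \<in> graph_roots G \<longleftrightarrow>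
        reflection (straight_root i j c) w \<in> graph_roots G"
      "reflection w (straight_root l k d) \<in> graph_roots G \<longleftrightarrow>
        reflection w (straight_root k l d) \<in> graph_roots G" for w
      by (cases c; simp add: straight_root_swap[of j i])
         (cases d; simp add: straight_root_swap[of l k])
    consider "k = i" | "k = j" | "l = i" | "l = j" | "k \<notin> {i, j}" "l \<notin> {i, j}" by blast
    then show ?thesis
    proof cases
      case 1
      then show ?thesis using common[of i j l] ij kl by auto
    next
      case 2
      then show ?thesis using common[of j i l] ij kl swap by (auto simp: insert_commute)
    next
      case 3
      then show ?thesis using common[of i j k] ij kl swap by (auto simp: insert_commute)
    next
      case 4
      then show ?thesis using common[of j i k] ij kl swap by (auto simp: insert_commute)
    next
      case 5
      then show ?thesis using ij kl by (simp add: reflection_straight_root_disjoint)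
    qed
  qed
  have straight_loop: "reflection (straight_root i j c) (loop_root k d) \<in> graph_roots G"
    if "i \<noteq> j" "({i, j}, c) \<in> G" "({k}, d) \<in> G" for i j k c d
  proof -
    consider "k = i" | "k = j" | "k \<notin> {i, j}" by blast
    then show ?thesis
    proof cases
      case 1
      then show ?thesis using that loop[of i j d c] by (simp add: reflection_straight_root_loop)
    next
      case 2
      then have "reflection (straight_root j i c) (loop_root k d) \<in> graph_roots G"
        using that loop[of j i d c] by (simp add: reflection_straight_root_loop insert_commute)
      then show ?thesis by (cases c) (simp_all add: straight_root_swap[of j i])
    next
      case 3
      then show ?thesis using that by (simp add: reflection_straight_root_loop_disjoint)
    qed
  qed
  have loop_straight: "reflection (loop_root k d) (straight_root i j c) \<in> graph_roots G"
    if "i \<noteq> j" "({i, j}, c) \<in> G" "({k}, d) \<in> G" for i j k c d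
  proof -
    consider "k = i" | "k = j" | "k \<notin> {i, j}" by blast
    then show ?thesis
    proof cases
      case 1
      then show ?thesis using that loop[of i j d c] by (simp add: reflection_loop_root_straight)
    next
      case 2
      then have "reflection (loop_root k d) (straight_root j i c) \<in> graph_roots G"
        using that loop[of j i d c] by (simp add: reflection_loop_root_straight insert_commute)
      then show ?thesis by (cases c) (simp_all add: straight_root_swap[of j i])
    next
      case 3
      then show ?thesis using that by (simp add: reflection_loop_root_straight_disjoint)
    qed
  qed
  from assms(2) show ?thesis
  proof (cases rule: graph_roots_cases)
    case \<alpha>: (straight i j c)
    from assms(3) show ?thesis
      by (cases rule: graph_roots_cases)
         (use \<alpha> straight_straight straight_loop in auto)
  next
    case \<alpha>: (loop k c)
    from assms(3) show ?thesis
    proof (cases rule: graph_roots_cases)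
      case (straight i j d)
      then show ?thesis using \<alpha> loop_straight by auto
    next
      case (loop l d)
      then show ?thesis using \<alpha> by (auto simp: reflection_loop_root_loop)
    qed
  qed
qed

text \<open>Conversely, each condition on the graph is one of these reflections read backwards. The
  triangle condition is a reflection of one side in another. In the loop condition, the reflection
  of the loop gives the loop at the other end, and the reflection in the loop gives the straight
  edge of the other colour.\<close>

lemma root_subsystem_graph_roots_iff:
  assumes "bichromatic_graph G"
  shows "root_subsystem (graph_roots G) \<longleftrightarrow> crystallograph G"
proof
  assume "crystallograph G"
  then have "\<forall>\<alpha>\<in>graph_roots G. reflection \<alpha> ` graph_roots G \<subseteq> graph_roots G"
    by (blast intro: crystallograph_closed)
  moreover have "graph_roots G \<subseteq> BC" unfolding graph_roots_eq by blast
  ultimately show "root_subsystem (graph_roots G)" by (simp add: root_subsystem_def)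
next
  assume "root_subsystem (graph_roots G)"
  then have refl: "reflection \<alpha> \<beta> \<in> graph_roots G"
    if "\<alpha> \<in> graph_roots G" "\<beta> \<in> graph_roots G" for \<alpha> \<beta>
    using that by (auto simp: root_subsystem_def)
  have "({i, k}, if c = d then Red else Green) \<in> G"
    if "i \<noteq> j" "j \<noteq> k" "i \<noteq> k" "({i, j}, c) \<in> G" "({j, k}, d) \<in> G" for i j k c d
    using refl[of "straight_root j i c" "straight_root j k d"] that
    by (auto simp: reflection_straight_root_adjacent insert_commute split: if_splits)
  moreover have "({i, j}, Red) \<in> G \<and> ({i, j}, Green) \<in> G \<and> ({j}, c) \<in> G"
    if "i \<noteq> j" "({i}, c) \<in> G" "({i, j}, d) \<in> G" for i j c d
    using refl[of "straight_root i j d" "loop_root i c"]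
      refl[of "loop_root i c" "straight_root i j d"] that
    by (cases d) (auto simp: reflection_straight_root_loop reflection_loop_root_straight)
  ultimately show "crystallograph G"
    using assms unfolding crystallograph_def by blast
qed

lemma root_subsystem_symmetric:
  assumes "root_subsystem \<Phi>"
  shows "\<Phi> \<subseteq> BC" "uminus ` \<Phi> \<subseteq> \<Phi>"
proof -
  show "\<Phi> \<subseteq> BC" using assms by (simp add: root_subsystem_def)
  show "uminus ` \<Phi> \<subseteq> \<Phi>"
  proof safe
    fix v assume v: "v \<in> \<Phi>"
    then have "reflection v v \<in> \<Phi>" using assms by (auto simp: root_subsystem_def)
    then show "- v \<in> \<Phi>" using reflection_self[of v] v \<open>\<Phi> \<subseteq> BC\<close> by auto
  qed
qed

theorem theorem3p1p3:
  "bij_betw graph_roots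
     {G :: 'n::finite coloured_graph. crystallograph G}
     {\<Phi> :: (complex ^ 'n) set. root_subsystem \<Phi>}"
proof (rule bij_betw_subset[OF bij_betw_graph_roots_symmetric])
  have bichromatic: "bichromatic_graph G" if "crystallograph G" for G :: "'n coloured_graph"
    using that by (simp add: crystallograph_def)
  then show "{G :: 'n coloured_graph. crystallograph G} \<subseteq> {G. bichromatic_graph G}"
    by blast
  have "\<Phi> \<in> graph_roots ` {G. crystallograph G}"
    if "root_subsystem \<Phi>" for \<Phi> :: "(complex ^ 'n) set"
  proof -
    have "\<Phi> \<in> graph_roots ` {G. bichromatic_graph G}"
      unfolding bij_betw_imp_surj_on[OF bij_betw_graph_roots_symmetric]
      using root_subsystem_symmetric[OF that] by blast
    with that show ?thesis by (auto simp: root_subsystem_graph_roots_iff)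
  qed
  moreover have "root_subsystem (graph_roots G)"
    if "crystallograph G" for G :: "'n coloured_graph"
    using that bichromatic by (simp add: root_subsystem_graph_roots_iff)
  ultimately show
    "graph_roots ` {G :: 'n coloured_graph. crystallograph G} = {\<Phi>. root_subsystem \<Phi>}"
    by blast
qed

end
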